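(* Let $n,m\in\mathbb{N}$, $f\in\mathcal{F}^n$ and $g\in\mathcal{F}^{n,m}_f$ with linked closed set $C\subset\mathbb{R}^m$, and let $\overline{x}\in\mathbb{R}^n$, $\overline{x}^*\in\mathbb{R}^m$. Then $\overline{x}^*$ is a solution of $(D_g)$ and $\overline{x}$ is a solution of $(P)$ if and only if $\gamma_{g,f}(\overline{x},\overline{x}^* )=0$.
   Context: $\overline{\mathbb{R}}=\mathbb{R}\cup\{-\infty,+\infty\}$. A non-negative function $g:\mathbb{R}^n\times\mathbb{R}^m\to\overline{\mathbb{R}}$ is a G-coupling function if there is a non-empty closed set $C\subset\mathbb{R}^m$ (the closed set linked to $g$) such that (D1) $g$ is real-valued on $\mathbb{R}^n\times C$ and $g(x,x^* )=+\infty$ for every $x\in\mathbb{R}^n$, $x^*\notin C$; (D2) $\inf_{x\in\mathbb{R}^n,\,x^*\in C}g(x,x^* )=0$. $\mathcal{F}^{n,m}$ is the set of all such functions. A function with values in $\mathbb{R}\cup\{+\infty\}$ is proper if it is not identically $+\infty$. $\mathcal{F}^n$ is the set of proper functions $f:\mathbb{R}^n\to\mathbb{R}\cup\{+\infty\}$ with $\inf f>-\infty$. For $f\in\mathcal{F}^n$ and $g\in\mathcal{F}^{n,m}$ with linked set $C$, define $f^g:C\to\mathbb{R}\cup\{+\infty\}$ by $f^g(x^* )=\sup_{x\in\mathbb{R}^n}\{g(x,x^* )-f(x)\}$, and $\gamma_{g,f}:\mathbb{R}^n\times\mathbb{R}^m\to\mathbb{R}\cup\{+\infty\}$ by $\gamma_{g,f}(x,x^*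 )=f(x)+f^g(x^* )$ if $x^*\in C$ and $+\infty$ otherwise. $\mathcal{F}^{n,m}_f=\{g\in\mathcal{F}^{n,m}: f^g\text{ is proper and }\inf\gamma_{g,f}=0\}$. $(P)$ is the problem $\min_{x\in\mathbb{R}^n}f(x)$; a solution is a point $\overline{x}\in\mathbb{R}^n$ with $f(\overline{x})=\inf f$. $(D_g)$ is the problem $\min_{x^*\in C}f^g(x^* )$; a solution is a point $\overline{x}^*\in C$ with $f^g(\overline{x}^* )=\inf_{x^*\in C}f^g(x^* )$. *)

theory Defs
  imports "HOL-Analysis.Analysis"
begin

text \<open>
  Functions into \<open>\<real> \<union> {+\<infinity>}\<close> are \<^typ>\<open>ereal\<close>-valued functions that avoid \<open>-\<infinity>\<close>.
\<close>

definition proper_on :: "'a set \<Rightarrow> ('a \<Rightarrow> ereal) \<Rightarrow> bool" where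
  "proper_on S h \<longleftrightarrow> (\<forall>x\<in>S. h x \<noteq> -\<infinity>) \<and> (\<exists>x\<in>S. h x \<noteq> \<infinity>)"

definition solution_on :: "'a set \<Rightarrow> ('a \<Rightarrow> ereal) \<Rightarrow> 'a \<Rightarrow> bool" where
  "solution_on S h x \<longleftrightarrow> x \<in> S \<and> h x = (INF y\<in>S. h y)"

definition proper_bounded_below :: "(real ^ 'n \<Rightarrow> ereal) set" where
  "proper_bounded_below = {f. proper_on UNIV f \<and> (INF x. f x) > -\<infinity>}"

definition linked_closed_set ::
    "((real ^ 'n) \<times> (real ^ 'm) \<Rightarrow> ereal) \<Rightarrow> (real ^ 'm) set \<Rightarrow> bool" where
  "linked_closed_set g C \<longleftrightarrow>
     C \<noteq> {} \<and> closed C \<and>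
     (\<forall>x. \<forall>y\<in>C. \<bar>g (x, y)\<bar> \<noteq> \<infinity>) \<and>
     (\<forall>x y. y \<notin> C \<longrightarrow> g (x, y) = \<infinity>) \<and>
     (INF p\<in>UNIV \<times> C. g p) = 0"

definition G_coupling :: "((real ^ 'n) \<times> (real ^ 'm) \<Rightarrow> ereal) set" where
  "G_coupling = {g. (\<forall>p. 0 \<le> g p) \<and> (\<exists>C. linked_closed_set g C)}"

lemma linked_closed_set_unique:
  assumes "linked_closed_set g C" "linked_closed_set g D"
  shows "C = D"
  using assms unfolding linked_closed_set_def by (metis abs_ereal.simps(3) subsetI subset_antisym)

text \<open>
  The conjugate \<open>f\<^sup>g\<close> has the linked set \<open>C\<close> of \<open>g\<close> as its domain. Here it is a total function
  whose values outside \<open>C\<close> carry no meaning; every notion below uses it on \<open>C\<close> only. On \<open>C\<close> the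
  difference is never of the form \<open>\<infinity> - \<infinity>\<close>, since \<open>g\<close> is finite there.
\<close>

definition G_conjugate ::
    "(real ^ 'n \<Rightarrow> ereal) \<Rightarrow> ((real ^ 'n) \<times> (real ^ 'm) \<Rightarrow> ereal) \<Rightarrow> real ^ 'm \<Rightarrow> ereal" where
  "G_conjugate f g y = (SUP x. g (x, y) - f x)"

definition gap ::
    "(real ^ 'm) set \<Rightarrow> (real ^ 'n \<Rightarrow> ereal) \<Rightarrow> ((real ^ 'n) \<times> (real ^ 'm) \<Rightarrow> ereal) \<Rightarrow>
      (real ^ 'n) \<times> (real ^ 'm) \<Rightarrow> ereal" where
  "gap C f g = (\<lambda>(x, y). if y \<in> C then f x + G_conjugate f g y else \<infinity>)"

text \<open>The set \<open>C\<close> below is unique by \<open>linked_closed_set_unique\<close>.\<close>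

definition G_coupling_for ::
    "(real ^ 'n \<Rightarrow> ereal) \<Rightarrow> ((real ^ 'n) \<times> (real ^ 'm) \<Rightarrow> ereal) set" where
  "G_coupling_for f =
     {g \<in> G_coupling. \<exists>C. linked_closed_set g C \<and>
        proper_on C (G_conjugate f g) \<and> (INF p. gap C f g p) = 0}"

end

theory Submission
  imports Defs
begin

text \<open>
  Since \<open>\<gamma>\<close> separates into a function of \<open>x\<close> plus a function of \<open>x\<^sup>*\<close>, the condition
  \<open>inf \<gamma> = 0\<close> says that the optimal values of the two problems are finite and add up to \<open>0\<close>.
  So \<open>\<gamma>\<close> vanishes at a pair exactly when neither summand exceeds its optimal value.
\<close>

text \<open>Weak duality: each \<open>- f x\<close> is a lower bound for \<open>h\<close> on
  \<open>B\<close>, so \<open>- f x\<close> \<le> inf \<open>h\<close>; then - inf \<open>h\<close>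
  is a lower bound for \<open>f\<close> on \<open>A\<close>.\<close>

lemma ereal_INF_add_INF_nonneg:
  fixes f :: "'a \<Rightarrow> ereal" and h :: "'b \<Rightarrow> ereal"
  assumes nonneg: "\<And>x y. x \<in> A \<Longrightarrow> y \<in> B \<Longrightarrow> 0 \<le> f x + h y"
    and f: "proper_on A f" and h: "proper_on B h"
  shows "\<bar>INF x\<in>A. f x\<bar> \<noteq> \<infinity>" "\<bar>INF y\<in>B. h y\<bar> \<noteq> \<infinity>" "0 \<le> (INF x\<in>A. f x) + (INF y\<in>B. h y)"
proof -
  have neg_le: "- f x \<le> h y" if "x \<in> A" "y \<in> B" for x y
    using nonneg[OF that] f h that unfolding proper_on_def
    by (cases "f x"; cases "h y") auto
  then have le_h: "- f x \<le> (INF y\<in>B. h y)" if "x \<in> A" for x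
    using that by (intro INF_greatest)
  then have le_f: "- (INF y\<in>B. h y) \<le> (INF x\<in>A. f x)"
    by (intro INF_greatest) (metis ereal_uminus_le_reorder)
  obtain x where x: "x \<in> A" "f x \<noteq> \<infinity>" "f x \<noteq> -\<infinity>"
    using f unfolding proper_on_def by blast
  obtain y where y: "y \<in> B" "h y \<noteq> \<infinity>" "h y \<noteq> -\<infinity>"
    using h unfolding proper_on_def by blast
  \<comment> \<open>Finite values bound each infimum above by its own function and below by the
    negative of the other.\<close>
  have "(INF y\<in>B. h y) \<le> h y" "(INF x\<in>A. f x) \<le> f x"
    using x y by (auto intro: INF_lower)
  then show fin_f: "\<bar>INF x\<in>A. f x\<bar> \<noteq> \<infinity>" and fin_h: "\<bar>INF y\<in>B. h y\<bar> \<noteq> \<infinity>"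
    using le_h[OF x(1)] le_f x y by auto
  show "0 \<le> (INF x\<in>A. f x) + (INF y\<in>B. h y)"
    using le_f fin_f fin_h by (cases "INF x\<in>A. f x"; cases "INF y\<in>B. h y") auto
qed

text \<open>Two nonnegative excesses over finite \<open>a\<close> and \<open>b\<close> cancel only
  if both vanish. Finiteness matters: an infinite \<open>a\<close> would absorb any excess of
  \<open>v\<close>.\<close>

lemma ereal_add_eq_iff_of_ge:
  fixes a b u v :: ereal
  assumes "\<bar>a\<bar> \<noteq> \<infinity>" "\<bar>b\<bar> \<noteq> \<infinity>" "a \<le> u" "b \<le> v"
  shows "u + v = a + b \<longleftrightarrow> u = a \<and> v = b"
  using assms by (cases a; cases b; cases u; cases v) auto

theorem theorem3p8:
  fixes f :: "real ^ 'n \<Rightarrow> ereal"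
    and g :: "(real ^ 'n) \<times> (real ^ 'm) \<Rightarrow> ereal"
    and C :: "(real ^ 'm) set"
    and xbar :: "real ^ 'n"
    and ybar :: "real ^ 'm"
  assumes "f \<in> proper_bounded_below"
    and "g \<in> G_coupling_for f"
    and "linked_closed_set g C"
  shows "solution_on C (G_conjugate f g) ybar \<and> solution_on UNIV f xbar
           \<longleftrightarrow> gap C f g (xbar, ybar) = 0"
proof -
  let ?h = "G_conjugate f g"
  let ?a = "INF x. f x" and ?b = "INF y\<in>C. ?h y"
  have f: "proper_on UNIV f"
    using assms(1) unfolding proper_bounded_below_def by blast
  \<comment> \<open>The linked set in \<open>G_coupling_for\<close> is existential; uniqueness
    identifies it with \<open>C\<close>.\<close>
  have h: "proper_on C ?h" and inf_gap: "(INF p. gap C f g p) = 0"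
    using assms(2,3) linked_closed_set_unique unfolding G_coupling_for_def by blast+
  have nonneg: "0 \<le> f x + ?h y" if "y \<in> C" for x y
    using INF_lower[of "(x, y)" UNIV "gap C f g"] that unfolding inf_gap by (simp add: gap_def)
  note opt = ereal_INF_add_INF_nonneg[of UNIV C f ?h, OF nonneg f h]
  \<comment> \<open>The converse of weak duality; points outside \<open>C\<close> have gap
    \<infinity> and impose nothing.\<close>
  have "?a + ?b \<le> (INF p. gap C f g p)"
    by (intro INF_greatest) (auto simp: gap_def intro!: add_mono INF_lower)
  with opt(3) inf_gap have sum_opt: "?a + ?b = 0"
    by simp
  show ?thesis
  proof (cases "ybar \<in> C")
    case True
    then have "f xbar + ?h ybar = ?a + ?b \<longleftrightarrow> f xbar = ?a \<and> ?h ybar = ?b"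
      by (intro ereal_add_eq_iff_of_ge opt INF_lower) auto
    with True sum_opt show ?thesis
      by (auto simp: gap_def solution_on_def)
  next
    case False
    then show ?thesis
      by (simp add: gap_def solution_on_def)
  qed
qed

end
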